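(* Let $\mathcal A$, $\mathcal B$ and $\mathcal R$ be sets (families of sets), and suppose that $\mathcal R$ is a reflection of $\mathcal A$. Then the games $G_1(\mathcal A,\mathcal B)$ and $G_1(\mathcal R,\neg\mathcal B)$ are both perfect information dual and Markov information dual. That is, all four of the following hold: \begin{itemize} \item Player I has a winning strategy in $G_1(\mathcal A,\mathcal B)$ if and only if Player II has a winning strategy in $G_1(\mathcal R,\neg\mathcal B)$; \item Player II has a winning strategy in $G_1(\mathcal A,\mathcal B)$ if and only if Player I has a winning strategy in $G_1(\mathcal R,\neg\mathcal B)$; \item Player I has a winning predetermined strategy in $G_1(\mathcal A,\mathcal B)$ if and only if Player II has a winning Markov strategy in $G_1(\mathcal R,\neg\mathcal B)$; \item Player II has a winning Markov strategy in $G_1(\mathcal A,\mathcal B)$ if and only if Player I has a winning predetermined strategy in $G_1(\mathcal R,\neg\mathcal B)$. \end{itemize}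
   Context: Choice functions: for a set $X$ of sets, $\mathbf C(X)=\{f\in(\bigcup X)^X : f(x)\in x \text{ for all } x\in X\}$ is the set of all choice functions on $X$; $\operatorname{ran} f$ is the range of $f$. Reflection: $\mathcal R$ is a reflection of $\mathcal A$ if $\{\operatorname{ran} f: f\in\mathbf C(\mathcal R)\}\subseteq\mathcal A$ and for every $A\in\mathcal A$ there is $f\in\mathbf C(\mathcal R)$ with $\operatorname{ran} f\subseteq A$. Selection game $G_1(\mathcal A,\mathcal B)$: in each round $n<\omega$, Player I chooses $A_n\in\mathcal A$, then Player II chooses $B_n\in A_n$. Player II wins if $\{B_n:n<\omega\}\in\mathcal B$; otherwise Player I wins. The first player to fail to make a legal move loses. The game $G_1(\mathcal A,\neg\mathcal B)$ has the same rules, but Player II wins if $\{B_n:n<\omega\}\notin\mathcal B$, and Player I wins otherwise. Strategies (in a game with Player I's choices from $\mathcal A$): - A strategy for Player I is a function $\sigma$ from finite sequences (including the empty one) of elements of $\bigcup\mathcal A$ to $\mathcal A$. It is winning if Player I wins every play in which I plays $A_n=\sigma(\langle B_0,\dots,B_{n-1}\rangle)$ in each round $n$ and II plays arbitrary legal moves $B_n\in A_n$. - A predetermined strategy for Player I is a function $\sigma:\omega\to\mathcal A$. It is winning if Player I wins every play in which I plays $A_n=\sigma(n)$ in each round and II plays arbitrary legal moves. - A strategy for Player II is a function $\sigma$ assigning to each nonempty finite sequence $\langle A_0,\dots,A_n\rangle$ of elements of $\mathcal A$ an element of $A_n$. It is winning if Player II wins every play in which I plays arbitrary $A_n\in\mathcal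 A$ and II plays $B_n=\sigma(\langle A_0,\dots,A_n\rangle)$. - A Markov strategy for Player II is a function $\sigma$ assigning to each pair $(A,n)\in\mathcal A\times\omega$ an element of $A$. It is winning if Player II wins every play in which I plays arbitrary $A_n\in\mathcal A$ and II plays $B_n=\sigma(A_n,n)$. *)

theory Defs
  imports Main "HOL-Library.FuncSet"
begin

definition choice_functions :: "'a set set \<Rightarrow> ('a set \<Rightarrow> 'a) set" where
  "choice_functions X = (\<Pi>\<^sub>E x\<in>X. x)"

definition reflection :: "'a set set \<Rightarrow> 'a set set \<Rightarrow> bool" where
  "reflection \<R> \<A> \<longleftrightarrow>
     {f ` \<R> | f. f \<in> choice_functions \<R>} \<subseteq> \<A> \<and>
     (\<forall>A\<in>\<A>. \<exists>f\<in>choice_functions \<R>. f ` \<R> \<subseteq> A)"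

text \<open>
  A single-selection game is given by the sets offered to Player I and by the family of those
  outcomes \<open>{B n | n. True}\<close> of infinite plays that are won by Player II.
\<close>

datatype 'a selection_game = Game (moves: "'a set set") (payoff: "'a set set")

definition G1 :: "'a set set \<Rightarrow> 'a set set \<Rightarrow> 'a selection_game" where
  "G1 \<A> \<B> = Game \<A> \<B>"

definition G1_not :: "'a set set \<Rightarrow> 'a set set \<Rightarrow> 'a selection_game" where
  "G1_not \<A> \<B> = Game \<A> {S. S \<notin> \<B>}"

text \<open>
  Strategies are total functions, constrained only on their mathematical domain. They always
  supply legal moves there, so a play against a strategy can end after finitely many rounds only
  because the opponent has no legal move, and then the owner of the strategy wins. Hence winning
  strategies need only be tested on infinite plays.
\<close>

definition strategy_I :: "'a selection_game \<Rightarrow> ('a list \<Rightarrow> 'a set) \<Rightarrow> bool" where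
  "strategy_I G \<sigma> \<longleftrightarrow> (\<forall>s\<in>lists (\<Union>(moves G)). \<sigma> s \<in> moves G)"

definition winning_I :: "'a selection_game \<Rightarrow> ('a list \<Rightarrow> 'a set) \<Rightarrow> bool" where
  "winning_I G \<sigma> \<longleftrightarrow>
     (\<forall>B :: nat \<Rightarrow> 'a. (\<forall>n. B n \<in> \<sigma> (map B [0..<n])) \<longrightarrow> range B \<notin> payoff G)"

definition predetermined_I :: "'a selection_game \<Rightarrow> (nat \<Rightarrow> 'a set) \<Rightarrow> bool" where
  "predetermined_I G \<sigma> \<longleftrightarrow> (\<forall>n. \<sigma> n \<in> moves G)"

definition winning_predetermined_I :: "'a selection_game \<Rightarrow> (nat \<Rightarrow> 'a set) \<Rightarrow> bool" where
  "winning_predetermined_I G \<sigma> \<longleftrightarrow>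
     (\<forall>B :: nat \<Rightarrow> 'a. (\<forall>n. B n \<in> \<sigma> n) \<longrightarrow> range B \<notin> payoff G)"

definition strategy_II :: "'a selection_game \<Rightarrow> ('a set list \<Rightarrow> 'a) \<Rightarrow> bool" where
  "strategy_II G \<sigma> \<longleftrightarrow> (\<forall>s\<in>lists (moves G). s \<noteq> [] \<longrightarrow> \<sigma> s \<in> last s)"

definition winning_II :: "'a selection_game \<Rightarrow> ('a set list \<Rightarrow> 'a) \<Rightarrow> bool" where
  "winning_II G \<sigma> \<longleftrightarrow>
     (\<forall>A :: nat \<Rightarrow> 'a set. (\<forall>n. A n \<in> moves G) \<longrightarrow>
        range (\<lambda>n. \<sigma> (map A [0..<Suc n])) \<in> payoff G)"

definition markov_II :: "'a selection_game \<Rightarrow> ('a set \<Rightarrow> nat \<Rightarrow> 'a) \<Rightarrow> bool" where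
  "markov_II G \<sigma> \<longleftrightarrow> (\<forall>A\<in>moves G. \<forall>n. \<sigma> A n \<in> A)"

definition winning_markov_II :: "'a selection_game \<Rightarrow> ('a set \<Rightarrow> nat \<Rightarrow> 'a) \<Rightarrow> bool" where
  "winning_markov_II G \<sigma> \<longleftrightarrow>
     (\<forall>A :: nat \<Rightarrow> 'a set. (\<forall>n. A n \<in> moves G) \<longrightarrow> range (\<lambda>n. \<sigma> (A n) n) \<in> payoff G)"

definition I_wins :: "'a selection_game \<Rightarrow> bool" where
  "I_wins G \<longleftrightarrow> (\<exists>\<sigma>. strategy_I G \<sigma> \<and> winning_I G \<sigma>)"

definition I_wins_predetermined :: "'a selection_game \<Rightarrow> bool" where
  "I_wins_predetermined G \<longleftrightarrow> (\<exists>\<sigma>. predetermined_I G \<sigma> \<and> winning_predetermined_I G \<sigma>)"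

definition II_wins :: "'a selection_game \<Rightarrow> bool" where
  "II_wins G \<longleftrightarrow> (\<exists>\<sigma>. strategy_II G \<sigma> \<and> winning_II G \<sigma>)"

definition II_wins_markov :: "'a selection_game \<Rightarrow> bool" where
  "II_wins_markov G \<longleftrightarrow> (\<exists>\<sigma>. markov_II G \<sigma> \<and> winning_markov_II G \<sigma>)"

definition perfect_information_dual :: "'a selection_game \<Rightarrow> 'a selection_game \<Rightarrow> bool" where
  "perfect_information_dual G H \<longleftrightarrow>
     (I_wins G \<longleftrightarrow> II_wins H) \<and> (II_wins G \<longleftrightarrow> I_wins H)"

definition markov_information_dual :: "'a selection_game \<Rightarrow> 'a selection_game \<Rightarrow> bool" where
  "markov_information_dual G H \<longleftrightarrow>
     (I_wins_predetermined G \<longleftrightarrow> II_wins_markov H) \<and>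
     (II_wins_markov G \<longleftrightarrow> I_wins_predetermined H)"

end

theory Submission imports Defs begin

text \<open>
  Being a reflection is not symmetric in \<open>\<A>\<close> and \<open>\<R>\<close>, but everything that the games need
  follows from three consequences (lemmas \<open>reflection_meets\<close>, \<open>reflection_traps\<close> and
  \<open>reflection_traps_converse\<close>) which together are symmetric:

  \<^item> each member of \<open>\<A>\<close> meets each member of \<open>\<R>\<close>;
  \<^item> whenever one element is selected from each member of one of the two families, some member
    of the other family consists of selected elements only.

  The first property turns a winning strategy of Player I into one of Player II in the other
  game: Player II keeps an imaginary play of the first game alongside the real one, and always
  answers with an element of the intersection of the set just offered with the set that the
  strategy of Player I offers in the imaginary play. Both plays then have the same outcome.

  The second property turns a winning strategy of Player II into one of Player I in the other
  game: at each position, Player II's possible answers to the next move form such a selection,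
  so Player I can offer a set all of whose elements are answers of Player II. Whatever the
  opponent picks can then be explained by a move in an imaginary play of the first game, and
  again both plays have the same outcome. With strategies depending only on the round (and on
  the last move), the same arguments apply round by round, without any imaginary history.

  Since the winning conditions of the two games are complementary and the three properties
  together are symmetric, these transfers give all eight implications.
\<close>

definition traps :: "'a set set \<Rightarrow> 'a set set \<Rightarrow> bool" where
  "traps \<Y> \<X> \<longleftrightarrow> (\<forall>g. (\<forall>S\<in>\<X>. g S \<in> S) \<longrightarrow> (\<exists>T\<in>\<Y>. T \<subseteq> g ` \<X>))"

lemma trapsD:
  assumes "traps \<Y> \<X>" and "\<And>S. S \<in> \<X> \<Longrightarrow> g S \<in> S"
  obtains T where "T \<in> \<Y>" "T \<subseteq> g ` \<X>"
  using assms unfolding traps_def by meson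

definition meets :: "'a set set \<Rightarrow> 'a set set \<Rightarrow> bool" where
  "meets \<X> \<Y> \<longleftrightarrow> (\<forall>S\<in>\<X>. \<forall>T\<in>\<Y>. S \<inter> T \<noteq> {})"

lemma meets_sym: "meets \<X> \<Y> \<Longrightarrow> meets \<Y> \<X>"
  unfolding meets_def by blast

lemma image_in_reflected:
  assumes "reflection \<R> \<A>" and "\<And>S. S \<in> \<R> \<Longrightarrow> g S \<in> S"
  shows "g ` \<R> \<in> \<A>"
proof -
  have "restrict g \<R> \<in> choice_functions \<R>"
    unfolding choice_functions_def using assms(2) by auto
  then have "restrict g \<R> ` \<R> \<in> \<A>"
    using assms(1) unfolding reflection_def by blast
  then show ?thesis by simp
qed

lemma reflection_meets:
  assumes "reflection \<R> \<A>"
  shows "meets \<A> \<R>"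
  unfolding meets_def
proof (intro ballI)
  fix A S assume "A \<in> \<A>" "S \<in> \<R>"
  then obtain f where "f \<in> choice_functions \<R>" "f ` \<R> \<subseteq> A"
    using assms unfolding reflection_def by blast
  with \<open>S \<in> \<R>\<close> have "f S \<in> A \<inter> S"
    unfolding choice_functions_def by auto
  then show "A \<inter> S \<noteq> {}" by blast
qed

lemma reflection_traps:
  assumes "reflection \<R> \<A>"
  shows "traps \<A> \<R>"
  unfolding traps_def using image_in_reflected[OF assms] by blast

text \<open>
  Otherwise each member of \<open>\<R>\<close> contains an element that is not selected. The set of these
  elements, one for each member of \<open>\<R>\<close>, belongs to \<open>\<A>\<close>, and so contains a selected element.
\<close>

lemma reflection_traps_converse:
  assumes "reflection \<R> \<A>"
  shows "traps \<R> \<A>"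
  unfolding traps_def
proof (intro allI impI, rule ccontr)
  fix g :: "'a set \<Rightarrow> 'a"
  assume g: "\<forall>A\<in>\<A>. g A \<in> A" and "\<not> (\<exists>T\<in>\<R>. T \<subseteq> g ` \<A>)"
  then have "\<forall>S\<in>\<R>. \<exists>x. x \<in> S \<and> x \<notin> g ` \<A>" by blast
  then obtain h where h: "\<And>S. S \<in> \<R> \<Longrightarrow> h S \<in> S \<and> h S \<notin> g ` \<A>"
    by metis
  then have "h ` \<R> \<in> \<A>" using image_in_reflected[OF assms] by blast
  with g have "g (h ` \<R>) \<in> h ` \<R>" by blast
  with h \<open>h ` \<R> \<in> \<A>\<close> show False by force
qed

text \<open>
  Player II rebuilds the imaginary play from the sets offered so far: the fold computes the
  list of the answers already given, which is the history seen by Player I's strategy. The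
  answers are the same in the imaginary and in the real play.
\<close>

lemma I_wins_imp_II_wins:
  assumes "I_wins (Game \<X> P)" and "meets \<X> \<Y>"
  shows "II_wins (Game \<Y> (- P))"
proof -
  from assms(1) obtain \<sigma>
    where \<sigma>: "\<And>s. s \<in> lists (\<Union>\<X>) \<Longrightarrow> \<sigma> s \<in> \<X>"
      and win: "\<And>B :: nat \<Rightarrow> 'a. (\<And>n. B n \<in> \<sigma> (map B [0..<n])) \<Longrightarrow> range B \<notin> P"
    unfolding I_wins_def strategy_I_def winning_I_def by auto
  define answer where "answer bs T = (SOME x. x \<in> \<sigma> bs \<inter> T)" for bs T
  define answers where "answers = foldl (\<lambda>bs T. bs @ [answer bs T]) []"
  define \<tau> where "\<tau> s = last (answers s)" for s
  have answers_snoc: "answers (s @ [T]) = answers s @ [answer (answers s) T]" for s T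
    by (simp add: answers_def)
  have answer: "answer bs T \<in> \<sigma> bs \<inter> T" if "bs \<in> lists (\<Union>\<X>)" "T \<in> \<Y>" for bs T
  proof -
    have "\<exists>x. x \<in> \<sigma> bs \<inter> T"
      using assms(2) \<sigma>[OF that(1)] that(2) unfolding meets_def by blast
    then show ?thesis unfolding answer_def by (rule someI_ex)
  qed
  have legal: "answers s \<in> lists (\<Union>\<X>)" if "s \<in> lists \<Y>" for s
    using that
  proof (induction s rule: rev_induct)
    case Nil
    then show ?case by (simp add: answers_def)
  next
    case (snoc T s)
    then have s: "answers s \<in> lists (\<Union>\<X>)" and "T \<in> \<Y>" by auto
    from answer[OF this] \<sigma>[OF s] have "answer (answers s) T \<in> \<Union>\<X>" by blast
    with s show ?case by (simp add: answers_snoc)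
  qed
  have \<tau>_snoc: "\<tau> (s @ [T]) \<in> \<sigma> (answers s) \<inter> T" if "s \<in> lists \<Y>" "T \<in> \<Y>" for s T
    using answer[OF legal] that by (simp add: \<tau>_def answers_snoc)
  have "strategy_II (Game \<Y> (- P)) \<tau>"
    unfolding strategy_II_def
  proof (intro ballI impI)
    fix s assume "s \<in> lists (moves (Game \<Y> (- P)))" "s \<noteq> []"
    then show "\<tau> s \<in> last s"
      using \<tau>_snoc by (cases s rule: rev_cases) auto
  qed
  moreover have "winning_II (Game \<Y> (- P)) \<tau>"
    unfolding winning_II_def
  proof (intro allI impI)
    fix A :: "nat \<Rightarrow> 'a set"
    assume A: "\<forall>n. A n \<in> moves (Game \<Y> (- P))"
    define B where "B n = \<tau> (map A [0..<Suc n])" for n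
    have answers_B: "answers (map A [0..<n]) = map B [0..<n]" for n
      by (induction n) (simp_all add: B_def \<tau>_def answers_snoc, simp add: answers_def)
    have "B n \<in> \<sigma> (map B [0..<n])" for n
    proof -
      have "map A [0..<n] \<in> lists \<Y>" "A n \<in> \<Y>" using A by auto
      from \<tau>_snoc[OF this] show ?thesis by (simp add: B_def[of n] answers_B)
    qed
    from win[OF this]
    show "range (\<lambda>n. \<tau> (map A [0..<Suc n])) \<in> payoff (Game \<Y> (- P))"
      by (simp add: B_def)
  qed
  ultimately show ?thesis unfolding II_wins_def by blast
qed

text \<open>
  The fold decodes the opponent's picks into an imaginary play of the first game to which
  Player II's strategy responds with exactly these picks.
\<close>

lemma II_wins_imp_I_wins:
  assumes "II_wins (Game \<X> P)" and "traps \<Y> \<X>"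
  shows "I_wins (Game \<Y> (- P))"
proof -
  from assms(1) obtain \<tau>
    where \<tau>: "\<And>s. s \<in> lists \<X> \<Longrightarrow> s \<noteq> [] \<Longrightarrow> \<tau> s \<in> last s"
      and win: "\<And>A :: nat \<Rightarrow> 'a set. (\<And>n. A n \<in> \<X>) \<Longrightarrow>
                  range (\<lambda>n. \<tau> (map A [0..<Suc n])) \<in> P"
    unfolding II_wins_def strategy_II_def winning_II_def by auto
  have trap: "\<exists>T\<in>\<Y>. T \<subseteq> (\<lambda>S. \<tau> (s @ [S])) ` \<X>" if "s \<in> lists \<X>" for s
  proof -
    have "\<tau> (s @ [S]) \<in> S" if "S \<in> \<X>" for S
      using \<tau>[of "s @ [S]"] \<open>s \<in> lists \<X>\<close> that by simp
    from trapsD[OF assms(2), of "\<lambda>S. \<tau> (s @ [S])", OF this] show ?thesis by metis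
  qed
  \<comment> \<open>Picks against which no imaginary play is possible may decode to illegal histories;
      there, too, the offered set must be legal, and the one for the empty history serves.\<close>
  have "\<forall>s. \<exists>T. T \<in> \<Y> \<and> (s \<in> lists \<X> \<longrightarrow> T \<subseteq> (\<lambda>S. \<tau> (s @ [S])) ` \<X>)"
    using trap trap[of "[]"] by blast
  then obtain offer where offer: "\<And>s. offer s \<in> \<Y>"
    and offer_sub: "\<And>s. s \<in> lists \<X> \<Longrightarrow> offer s \<subseteq> (\<lambda>S. \<tau> (s @ [S])) ` \<X>"
    by metis
  define explain where "explain s b = (SOME S. S \<in> \<X> \<and> \<tau> (s @ [S]) = b)" for s b
  define decode where "decode = foldl (\<lambda>s b. s @ [explain s b]) []"
  have explain: "explain s b \<in> \<X> \<and> \<tau> (s @ [explain s b]) = b"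
    if "s \<in> lists \<X>" "b \<in> offer s" for s b
  proof -
    have "\<exists>S. S \<in> \<X> \<and> \<tau> (s @ [S]) = b" using offer_sub that by blast
    then show ?thesis unfolding explain_def by (rule someI_ex)
  qed
  have "strategy_I (Game \<Y> (- P)) (\<lambda>bs. offer (decode bs))"
    unfolding strategy_I_def by (simp add: offer)
  moreover have "winning_I (Game \<Y> (- P)) (\<lambda>bs. offer (decode bs))"
    unfolding winning_I_def
  proof (intro allI impI)
    fix B :: "nat \<Rightarrow> 'a"
    assume B: "\<forall>n. B n \<in> offer (decode (map B [0..<n]))"
    define A where "A n = explain (decode (map B [0..<n])) (B n)" for n
    have decode_B: "decode (map B [0..<n]) = map A [0..<n]" for n
      by (induction n) (simp_all add: A_def decode_def)
    have legal: "map A [0..<n] \<in> lists \<X>" for n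
    proof (induction n)
      case (Suc n)
      have "A n \<in> \<X>"
        using explain[OF Suc, of "B n"] B by (simp add: A_def[of n] decode_B)
      with Suc show ?case by simp
    qed simp
    have "A n \<in> \<X> \<and> \<tau> (map A [0..<Suc n]) = B n" for n
      using explain[OF legal[of n], of "B n"] B by (simp add: A_def[of n] decode_B)
    with win[of A] show "range B \<notin> payoff (Game \<Y> (- P))" by simp
  qed
  ultimately show ?thesis unfolding I_wins_def by blast
qed

lemma I_wins_predetermined_imp_II_wins_markov:
  assumes "I_wins_predetermined (Game \<X> P)" and "meets \<X> \<Y>"
  shows "II_wins_markov (Game \<Y> (- P))"
proof -
  from assms(1) obtain \<sigma> where \<sigma>: "\<And>n. \<sigma> n \<in> \<X>"
    and win: "\<And>B :: nat \<Rightarrow> 'a. (\<And>n. B n \<in> \<sigma> n) \<Longrightarrow> range B \<notin> P"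
    unfolding I_wins_predetermined_def predetermined_I_def winning_predetermined_I_def by auto
  have "\<forall>T n. \<exists>x. T \<in> \<Y> \<longrightarrow> x \<in> \<sigma> n \<inter> T"
    using assms(2) \<sigma> unfolding meets_def by blast
  then obtain \<tau> where \<tau>: "\<And>T n. T \<in> \<Y> \<Longrightarrow> \<tau> T n \<in> \<sigma> n \<inter> T" by metis
  have "markov_II (Game \<Y> (- P)) \<tau>"
    unfolding markov_II_def using \<tau> by auto
  moreover have "winning_markov_II (Game \<Y> (- P)) \<tau>"
    unfolding winning_markov_II_def using \<tau> win by auto
  ultimately show ?thesis unfolding II_wins_markov_def by blast
qed

lemma II_wins_markov_imp_I_wins_predetermined:
  assumes "II_wins_markov (Game \<X> P)" and "traps \<Y> \<X>"
  shows "I_wins_predetermined (Game \<Y> (- P))"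
proof -
  from assms(1) obtain \<tau> where \<tau>: "\<And>S n. S \<in> \<X> \<Longrightarrow> \<tau> S n \<in> S"
    and win: "\<And>A :: nat \<Rightarrow> 'a set. (\<And>n. A n \<in> \<X>) \<Longrightarrow> range (\<lambda>n. \<tau> (A n) n) \<in> P"
    unfolding II_wins_markov_def markov_II_def winning_markov_II_def by auto
  have "\<forall>n. \<exists>T. T \<in> \<Y> \<and> T \<subseteq> (\<lambda>S. \<tau> S n) ` \<X>"
  proof
    fix n
    from trapsD[OF assms(2), of "\<lambda>S. \<tau> S n", OF \<tau>]
    show "\<exists>T. T \<in> \<Y> \<and> T \<subseteq> (\<lambda>S. \<tau> S n) ` \<X>" by metis
  qed
  then obtain \<sigma> where \<sigma>: "\<And>n. \<sigma> n \<in> \<Y>" "\<And>n. \<sigma> n \<subseteq> (\<lambda>S. \<tau> S n) ` \<X>" by metis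
  have "predetermined_I (Game \<Y> (- P)) \<sigma>"
    unfolding predetermined_I_def by (simp add: \<sigma>)
  moreover have "winning_predetermined_I (Game \<Y> (- P)) \<sigma>"
    unfolding winning_predetermined_I_def
  proof (intro allI impI)
    fix B :: "nat \<Rightarrow> 'a" assume "\<forall>n. B n \<in> \<sigma> n"
    then have "B n \<in> (\<lambda>S. \<tau> S n) ` \<X>" for n
      using \<sigma>(2)[of n] by (meson subsetD)
    then have "\<forall>n. \<exists>S. S \<in> \<X> \<and> \<tau> S n = B n" by (metis imageE)
    then obtain A where "\<And>n. A n \<in> \<X>" "\<And>n. \<tau> (A n) n = B n" by metis
    with win[of A] show "range B \<notin> payoff (Game \<Y> (- P))" by simp
  qed
  ultimately show ?thesis unfolding I_wins_predetermined_def by blast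
qed

theorem corollary17:
  fixes \<A> \<B> \<R> :: "'a set set"
  assumes "reflection \<R> \<A>"
  shows "perfect_information_dual (G1 \<A> \<B>) (G1_not \<R> \<B>) \<and>
         markov_information_dual (G1 \<A> \<B>) (G1_not \<R> \<B>)"
proof -
  have games: "G1 \<A> \<B> = Game \<A> (- (- \<B>))" "G1 \<A> \<B> = Game \<A> \<B>"
      "G1_not \<R> \<B> = Game \<R> (- \<B>)"
    unfolding G1_def G1_not_def by auto
  note meets = reflection_meets[OF assms] meets_sym[OF reflection_meets[OF assms]]
  note traps = reflection_traps[OF assms] reflection_traps_converse[OF assms]
  have "I_wins (G1 \<A> \<B>) \<longleftrightarrow> II_wins (G1_not \<R> \<B>)"
    using I_wins_imp_II_wins[of \<A> \<B> \<R>] II_wins_imp_I_wins[of \<R> "- \<B>" \<A>]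
      meets traps games by auto
  moreover have "II_wins (G1 \<A> \<B>) \<longleftrightarrow> I_wins (G1_not \<R> \<B>)"
    using II_wins_imp_I_wins[of \<A> \<B> \<R>] I_wins_imp_II_wins[of \<R> "- \<B>" \<A>]
      meets traps games by auto
  moreover have "I_wins_predetermined (G1 \<A> \<B>) \<longleftrightarrow> II_wins_markov (G1_not \<R> \<B>)"
    using I_wins_predetermined_imp_II_wins_markov[of \<A> \<B> \<R>]
      II_wins_markov_imp_I_wins_predetermined[of \<R> "- \<B>" \<A>] meets traps games by auto
  moreover have "II_wins_markov (G1 \<A> \<B>) \<longleftrightarrow> I_wins_predetermined (G1_not \<R> \<B>)"
    using II_wins_markov_imp_I_wins_predetermined[of \<A> \<B> \<R>]
      I_wins_predetermined_imp_II_wins_markov[of \<R> "- \<B>" \<A>] meets traps games by auto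
  ultimately show ?thesis
    unfolding perfect_information_dual_def markov_information_dual_def by blast
qed

end
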